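(* Let $\mathcal{M}$ be any class of environments (chronological contextual semimeasures) that contains every computable chronological contextual measure. Then every (possibly stochastic) policy $\pi$ is Pareto optimal in $\mathcal{M}$: there is no policy $\tilde\pi$ such that $V^{\tilde\pi}_\nu(\epsilon)\ge V^{\pi}_\nu(\epsilon)$ for all $\nu\in\mathcal{M}$ and $V^{\tilde\pi}_\rho(\epsilon)>V^{\pi}_\rho(\epsilon)$ for at least one $\rho\in\mathcal{M}$.
   Context: The action set $\mathcal{A}$ and the percept set $\mathcal{E}$ are finite; a percept is a pair $e=(o,r)$ of an observation $o$ and a reward $r\in[0,1]$. The percept set contains percepts $(o,0)$ and $(o,1)$ for some observation $o$. A history is $\ae_{<t}=a_1e_1\ldots a_{t-1}e_{t-1}\in(\mathcal{A}\times\mathcal{E})^*$; $\epsilon$ is the empty history. A policy $\pi$ maps each history to a probability distribution $\pi(\cdot\mid\ae_{<t})$ on $\mathcal{A}$. A chronological contextual semimeasure $\nu$ assigns to all equal-length sequences $e_{1:t}\in\mathcal{E}^t$, $a_{1:t}\in\mathcal{A}^t$ a number $\nu(e_{1:t}\,\|\,a_{1:t})\in[0,1]$ with $\nu(\epsilon\,\|\,\epsilon)\le 1$ and $\sum_{e_t\in\mathcal{E}}\nu(e_{1:t}\,\|\,a_{1:t})\le\nu(e_{<t}\,\|\,a_{<t})$ for all $a_t\in\mathcal{A}$; it is a measure if equality always holds. The discount function $\gamma:\mathbb{N}\to\mathbb{R}_{\ge0}$ is computable with $\sum_{t\ge1}\gamma_t<\infty$, and $\Gamma_t:=\sum_{k\ge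 t}\gamma_k$. The value at the empty history is $$V^\pi_\nu(\epsilon)=\frac1{\Gamma_1}\sum_{k=1}^\infty\gamma_k\sum_{\ae_{1:k}} r_k\,\nu(e_{1:k}\,\|\,a_{1:k})\prod_{i=1}^k\pi(a_i\mid\ae_{<i})$$ if $\Gamma_1>0$ and $V^\pi_\nu(\epsilon)=0$ if $\Gamma_1=0$. *)

theory Defs
  imports
    "HOL-Probability.Probability_Mass_Function"
    "HOL-Library.Nat_Bijection"
    "HOL-Library.Countable_Set"
    "HOL-Library.FuncSet"
begin

section \<open>Computability\<close>

text \<open>
  Kleene's total (general) recursive functions: \<^term>\<open>n\<close>-ary functions are represented as functions
  on lists, of which only the values on lists of length \<^term>\<open>n\<close> matter (rule \<open>ext\<close>).
  Minimisation is applied to regular functions only, so that every function is total.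
\<close>

inductive recursive_fn :: "nat \<Rightarrow> (nat list \<Rightarrow> nat) \<Rightarrow> bool" where
  zero: "recursive_fn n (\<lambda>_. 0)"
| succ: "recursive_fn 1 (\<lambda>xs. Suc (xs ! 0))"
| proj: "i < n \<Longrightarrow> recursive_fn n (\<lambda>xs. xs ! i)"
| comp: "recursive_fn (length gs) f \<Longrightarrow> (\<forall>g\<in>set gs. recursive_fn n g) \<Longrightarrow>
    recursive_fn n (\<lambda>xs. f (map (\<lambda>g. g xs) gs))"
| prim: "recursive_fn n f \<Longrightarrow> recursive_fn (Suc (Suc n)) g \<Longrightarrow>
    recursive_fn (Suc n) (\<lambda>xs. rec_nat (f (tl xs)) (\<lambda>m r. g (m # r # tl xs)) (hd xs))"
| minim: "recursive_fn (Suc n) f \<Longrightarrow> (\<forall>xs. length xs = n \<longrightarrow> (\<exists>m. f (m # xs) = 0)) \<Longrightarrow>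
    recursive_fn n (\<lambda>xs. LEAST m. f (m # xs) = 0)"
| ext: "recursive_fn n f \<Longrightarrow> (\<forall>xs. length xs = n \<longrightarrow> g xs = f xs) \<Longrightarrow> recursive_fn n g"

text \<open>
  A real-valued function on \<^term>\<open>S\<close>, whose elements are coded as natural numbers by \<^term>\<open>code\<close>, is
  computable if a recursive function yields, for each argument and each \<^term>\<open>k\<close>, a rational
  \<open>(-1)^s * p / (q + 1)\<close> at distance at most \<open>2^-k\<close> from the value.
\<close>

definition computable_real_on :: "('x \<Rightarrow> nat) \<Rightarrow> 'x set \<Rightarrow> ('x \<Rightarrow> real) \<Rightarrow> bool" where
  "computable_real_on code S f \<longleftrightarrow>
    (\<exists>s p q. recursive_fn 2 s \<and> recursive_fn 2 p \<and> recursive_fn 2 q \<and>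
      (\<forall>x\<in>S. \<forall>k.
        \<bar>f x - (-1) ^ s [code x, k] * real (p [code x, k]) / real (Suc (q [code x, k]))\<bar>
          \<le> 1 / 2 ^ k))"


section \<open>Histories, policies and environments\<close>

text \<open>A percept is a pair of an observation and a reward.\<close>

type_synonym 'o percept = "'o \<times> real"
type_synonym ('a, 'o) history = "('a \<times> 'o percept) list"
type_synonym ('a, 'o) policy = "('a, 'o) history \<Rightarrow> 'a pmf"

text \<open>
  A pair of sequences \<open>e\<^sub>1\<dots>e\<^sub>t\<close> and \<open>a\<^sub>1\<dots>a\<^sub>t\<close> of equal length is the same thing as the list
  \<open>[(a\<^sub>1, e\<^sub>1), \<dots>, (a\<^sub>t, e\<^sub>t)]\<close>, so the number \<open>\<nu>(e\<^sub>1\<dots>e\<^sub>t \<parallel> a\<^sub>1\<dots>a\<^sub>t)\<close> is written as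
  \<open>\<nu> [(a\<^sub>1, e\<^sub>1), \<dots>, (a\<^sub>t, e\<^sub>t)]\<close>.
\<close>

type_synonym ('a, 'o) environment = "('a, 'o) history \<Rightarrow> real"

definition histories :: "'a set \<Rightarrow> 'o percept set \<Rightarrow> ('a, 'o) history set" where
  "histories A E = lists (A \<times> E)"

definition is_policy :: "'a set \<Rightarrow> 'o percept set \<Rightarrow> ('a, 'o) policy \<Rightarrow> bool" where
  "is_policy A E \<pi> \<longleftrightarrow> (\<forall>h\<in>histories A E. set_pmf (\<pi> h) \<subseteq> A)"

text \<open>
  The extensional function space fixes the irrelevant values of an environment outside
  the histories, so that equality of environments is equality on histories.
\<close>

definition ccs :: "'a set \<Rightarrow> 'o percept set \<Rightarrow> ('a, 'o) environment \<Rightarrow> bool" where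
  "ccs A E \<nu> \<longleftrightarrow>
    \<nu> \<in> histories A E \<rightarrow>\<^sub>E {0..1} \<and>
    \<nu> [] \<le> 1 \<and>
    (\<forall>h\<in>histories A E. \<forall>a\<in>A. (\<Sum>e\<in>E. \<nu> (h @ [(a, e)])) \<le> \<nu> h)"

definition ccm :: "'a set \<Rightarrow> 'o percept set \<Rightarrow> ('a, 'o) environment \<Rightarrow> bool" where
  "ccm A E \<nu> \<longleftrightarrow>
    ccs A E \<nu> \<and>
    \<nu> [] = 1 \<and>
    (\<forall>h\<in>histories A E. \<forall>a\<in>A. (\<Sum>e\<in>E. \<nu> (h @ [(a, e)])) = \<nu> h)"

text \<open>
  Histories are words over the finite alphabet \<^term>\<open>A \<times> E\<close>, whose letters \<^const>\<open>to_nat_on\<close>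
  numbers by an arbitrary bijection onto an initial segment of the naturals. Another
  numbering differs by a finite permutation and gives the same computable environments.
\<close>

definition history_code :: "'a set \<Rightarrow> 'o percept set \<Rightarrow> ('a, 'o) history \<Rightarrow> nat" where
  "history_code A E h = list_encode (map (to_nat_on (A \<times> E)) h)"

definition computable_env :: "'a set \<Rightarrow> 'o percept set \<Rightarrow> ('a, 'o) environment \<Rightarrow> bool" where
  "computable_env A E \<nu> \<longleftrightarrow> computable_real_on (history_code A E) (histories A E) \<nu>"


section \<open>Discounting, value and Pareto optimality\<close>

text \<open>Time steps start at 1; the value of a discount function at 0 is never used.\<close>

definition discount :: "(nat \<Rightarrow> real) \<Rightarrow> bool" where
  "discount \<gamma> \<longleftrightarrow>
    (\<forall>t\<ge>1. 0 \<le> \<gamma> t) \<and> computable_real_on id {1..} \<gamma> \<and> summable (\<lambda>k. \<gamma> (k + 1))"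

definition discount_tail :: "(nat \<Rightarrow> real) \<Rightarrow> nat \<Rightarrow> real" where
  "discount_tail \<gamma> t = (\<Sum>k. \<gamma> (k + t))"

definition policy_weight :: "('a, 'o) policy \<Rightarrow> ('a, 'o) history \<Rightarrow> real" where
  "policy_weight \<pi> h = (\<Prod>i<length h. pmf (\<pi> (take i h)) (fst (h ! i)))"

definition last_reward :: "('a, 'o) history \<Rightarrow> real" where
  "last_reward h = snd (snd (last h))"

definition expected_reward ::
    "'a set \<Rightarrow> 'o percept set \<Rightarrow> ('a, 'o) policy \<Rightarrow> ('a, 'o) environment \<Rightarrow> nat \<Rightarrow> real" where
  "expected_reward A E \<pi> \<nu> k =
    (\<Sum>h | h \<in> histories A E \<and> length h = k. last_reward h * \<nu> h * policy_weight \<pi> h)"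

definition policy_value ::
    "'a set \<Rightarrow> 'o percept set \<Rightarrow> (nat \<Rightarrow> real) \<Rightarrow> ('a, 'o) policy \<Rightarrow> ('a, 'o) environment \<Rightarrow> real" where
  "policy_value A E \<gamma> \<pi> \<nu> =
    (if discount_tail \<gamma> 1 > 0
     then 1 / discount_tail \<gamma> 1 * (\<Sum>k. \<gamma> (k + 1) * expected_reward A E \<pi> \<nu> (k + 1))
     else 0)"

definition pareto_optimal ::
    "'a set \<Rightarrow> 'o percept set \<Rightarrow> (nat \<Rightarrow> real) \<Rightarrow> ('a, 'o) environment set \<Rightarrow> ('a, 'o) policy \<Rightarrow> bool"
  where
  "pareto_optimal A E \<gamma> M \<pi> \<longleftrightarrow>
    \<not> (\<exists>\<pi>'. is_policy A E \<pi>' \<and>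
        (\<forall>\<nu>\<in>M. policy_value A E \<gamma> \<pi>' \<nu> \<ge> policy_value A E \<gamma> \<pi> \<nu>) \<and>
        (\<exists>\<rho>\<in>M. policy_value A E \<gamma> \<pi>' \<rho> > policy_value A E \<gamma> \<pi> \<rho>))"

end

theory Submission imports Defs begin

text \<open>
  If two policies differ in value in some environment, then their weights differ on some history
  whose length \<open>k\<close> satisfies \<open>\<gamma>\<^sub>k > 0\<close>. For every policy the weights of all histories of length \<open>k\<close>
  sum to \<open>|E|\<^sup>k\<close>, so on some history \<open>g\<close> the given policy has strictly more weight than its
  supposed dominator. Since weights ignore the last percept, \<open>g\<close> may be taken to end with reward 1.
  The deterministic environment that replays the percepts of \<open>g\<close> whatever the actions are, gives
  reward 1 at time \<open>k\<close> only if the actions of \<open>g\<close> were taken, and gives reward 0 ever after,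
  separates the two values by \<open>\<gamma>\<^sub>k / \<Gamma>\<^sub>1\<close> times the difference of the weights of \<open>g\<close>. Its histories
  form a language of the shape \<open>F \<union> T Z\<^sup>*\<close> with \<open>F\<close>, \<open>T\<close> and \<open>Z\<close> finite, hence it is computable.
\<close>

section \<open>Recursive functions and recursive languages\<close>

lemma recursive_comp1:
  assumes "recursive_fn 1 (\<lambda>xs. F (xs ! 0))" "recursive_fn n f"
  shows "recursive_fn n (\<lambda>xs. F (f xs))"
  using recursive_fn.comp[of "[f]" "\<lambda>xs. F (xs ! 0)" n] assms by simp

lemma recursive_comp2:
  assumes "recursive_fn 2 (\<lambda>xs. F (xs ! 0) (xs ! 1))" "recursive_fn n f" "recursive_fn n g"
  shows "recursive_fn n (\<lambda>xs. F (f xs) (g xs))"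
  using recursive_fn.comp[of "[f, g]" "\<lambda>xs. F (xs ! 0) (xs ! 1)" n] assms
  by (simp add: numeral_2_eq_2)

lemma recursive_Suc: "recursive_fn n f \<Longrightarrow> recursive_fn n (\<lambda>xs. Suc (f xs))"
  by (rule recursive_comp1[OF recursive_fn.succ])

lemma recursive_const: "recursive_fn n (\<lambda>_. c)"
  by (induction c) (auto intro: recursive_fn.zero recursive_Suc)

lemma recursive_rec_nat:
  assumes "recursive_fn 2 (\<lambda>xs. g (xs ! 0) (xs ! 1))" "recursive_fn n f"
  shows "recursive_fn n (\<lambda>xs. rec_nat c g (f xs))"
proof (rule recursive_comp1[OF _ assms(2)])
  \<comment> \<open>On lists of length one \<open>tl xs\<close> is empty, so \<open>c\<close> enters
    as a nullary constant and the step function sees only \<open>m\<close> and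
    \<open>r\<close>.\<close>
  have "recursive_fn (Suc 0) (\<lambda>xs. rec_nat c (\<lambda>m r. g ((m # r # tl xs) ! 0) ((m # r # tl xs) ! 1)) (hd xs))"
    using assms(1) by (intro recursive_fn.prim recursive_const) (simp add: numeral_2_eq_2)
  then show "recursive_fn 1 (\<lambda>xs. rec_nat c g (xs ! 0))"
    by (auto elim!: recursive_fn.ext simp: length_Suc_conv)
qed

text \<open>Iteration is primitive recursion whose step ignores the counter. It supplies addition,
  truncated subtraction and, with exponent 0 or 1, case distinctions.\<close>

lemma recursive_funpow:
  assumes "recursive_fn 1 (\<lambda>xs. F (xs ! 0))" "recursive_fn n f" "recursive_fn n g"
  shows "recursive_fn n (\<lambda>xs. (F ^^ f xs) (g xs))"
proof (rule recursive_comp2[OF _ assms(2,3)])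
  have "recursive_fn (Suc (Suc 0)) (\<lambda>xs. rec_nat (tl xs ! 0) (\<lambda>m r. F ((m # r # tl xs) ! 1)) (hd xs))"
    by (intro recursive_fn.prim recursive_comp1[OF assms(1)] recursive_fn.proj) auto
  moreover have "(F ^^ k) x = rec_nat x (\<lambda>m. F) k" for k x
    by (induction k) auto
  ultimately show "recursive_fn 2 (\<lambda>xs. (F ^^ (xs ! 0)) (xs ! 1))"
    by (auto elim!: recursive_fn.ext simp: length_Suc_conv numeral_2_eq_2)
qed

lemma recursive_add:
  assumes "recursive_fn n f" "recursive_fn n g"
  shows "recursive_fn n (\<lambda>xs. f xs + g xs)"
  using recursive_funpow[OF recursive_fn.succ assms] by simp

lemma recursive_pred:
  assumes "recursive_fn n f"
  shows "recursive_fn n (\<lambda>xs. f xs - 1)"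
proof -
  have "recursive_fn n (\<lambda>xs. rec_nat 0 (\<lambda>m r. m) (f xs))"
    by (intro recursive_rec_nat recursive_fn.proj assms) auto
  moreover have "rec_nat 0 (\<lambda>m r. m) k = k - 1" for k :: nat
    by (cases k) auto
  ultimately show ?thesis by simp
qed

lemma recursive_diff:
  assumes "recursive_fn n f" "recursive_fn n g"
  shows "recursive_fn n (\<lambda>xs. f xs - g xs)"
proof -
  have "recursive_fn n (\<lambda>xs. ((\<lambda>x. x - 1) ^^ g xs) (f xs))"
    by (intro recursive_funpow recursive_pred recursive_fn.proj assms) auto
  moreover have "((\<lambda>x. x - 1) ^^ k) x = x - k" for k x :: nat
    by (induction k) auto
  ultimately show ?thesis by simp
qed

lemma recursive_Not:
  assumes "recursive_fn n (\<lambda>xs. of_bool (P xs))"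
  shows "recursive_fn n (\<lambda>xs. of_bool (\<not> P xs))"
proof -
  have "recursive_fn n (\<lambda>xs. 1 - of_bool (P xs))"
    by (intro recursive_diff recursive_const assms)
  moreover have "(1 - of_bool b :: nat) = of_bool (\<not> b)" for b
    by auto
  ultimately show ?thesis by simp
qed

lemma recursive_conj:
  assumes "recursive_fn n (\<lambda>xs. of_bool (P xs))" "recursive_fn n (\<lambda>xs. of_bool (Q xs))"
  shows "recursive_fn n (\<lambda>xs. of_bool (P xs \<and> Q xs))"
proof -
  have "recursive_fn n (\<lambda>xs. of_bool (P xs) + of_bool (Q xs) - 1)"
    by (intro recursive_pred recursive_add assms)
  moreover have "(of_bool p + of_bool q - 1 :: nat) = of_bool (p \<and> q)" for p q
    by auto
  ultimately show ?thesis by simp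
qed

lemma recursive_disj:
  assumes "recursive_fn n (\<lambda>xs. of_bool (P xs))" "recursive_fn n (\<lambda>xs. of_bool (Q xs))"
  shows "recursive_fn n (\<lambda>xs. of_bool (P xs \<or> Q xs))"
  using recursive_Not[OF recursive_conj[OF recursive_Not[OF assms(1)] recursive_Not[OF assms(2)]]]
  by simp

lemma recursive_eq:
  assumes "recursive_fn n f" "recursive_fn n g"
  shows "recursive_fn n (\<lambda>xs. of_bool (f xs = g xs))"
proof -
  \<comment> \<open>At most one of the truncated differences is nonzero, so their sum is the
    distance of the two values.\<close>
  have "recursive_fn n (\<lambda>xs. 1 - ((f xs - g xs) + (g xs - f xs)))"
    by (intro recursive_diff recursive_add recursive_const assms)
  moreover have "(1 - ((x - y) + (y - x)) :: nat) = of_bool (x = y)" for x y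
    by auto
  ultimately show ?thesis by simp
qed

lemma recursive_finite_mem:
  assumes "finite Z" "recursive_fn n f"
  shows "recursive_fn n (\<lambda>xs. of_bool (f xs \<in> Z))"
  using assms(1)
proof induction
  case empty
  then show ?case using recursive_const[of n 0] by simp
next
  case (insert z Z)
  then show ?case
    using recursive_disj[OF recursive_eq[OF assms(2) recursive_const[of n z]] insert.IH] by simp
qed

section \<open>Recursive decoding of Cantor pairs\<close>

lemma recursive_triangle:
  assumes "recursive_fn n f"
  shows "recursive_fn n (\<lambda>xs. triangle (f xs))"
proof -
  have "recursive_fn n (\<lambda>xs. rec_nat 0 (\<lambda>m r. r + Suc m) (f xs))"
    by (intro recursive_rec_nat recursive_add recursive_Suc recursive_fn.proj assms) auto
  moreover have "rec_nat 0 (\<lambda>m r. r + Suc m) k = triangle k" for k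
    by (induction k) auto
  ultimately show ?thesis by simp
qed

lemma triangle_mono: "m \<le> n \<Longrightarrow> triangle m \<le> triangle n"
  by (rule lift_Suc_mono_le[of triangle]) auto

text \<open>Truncated subtraction turns \<open>n < triangle (Suc s)\<close> into the vanishing of a term.\<close>

lemma Least_triangle_prod_encode:
  "(LEAST s. Suc (prod_encode (x, y)) - triangle (Suc s) = 0) = x + y"
proof (rule Least_equality)
  show "Suc (prod_encode (x, y)) - triangle (Suc (x + y)) = 0"
    by (simp add: prod_encode_def)
next
  fix s assume *: "Suc (prod_encode (x, y)) - triangle (Suc s) = 0"
  show "x + y \<le> s"
  proof (rule ccontr)
    assume "\<not> x + y \<le> s"
    then have "triangle (Suc s) \<le> triangle (x + y)"
      by (intro triangle_mono) simp
    with * show False by (simp add: prod_encode_def)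
  qed
qed

text \<open>The pair (x, y) has code \<open>triangle (x + y) + x\<close>. Minimisation finds the
  diagonal x + y, called \<open>root\<close>; subtracting its triangle from the code leaves x, and
  \<open>root\<close> minus x is y.\<close>

lemma
  assumes "recursive_fn n f"
  shows recursive_fst_prod_decode: "recursive_fn n (\<lambda>xs. fst (prod_decode (f xs)))"
    and recursive_snd_prod_decode: "recursive_fn n (\<lambda>xs. snd (prod_decode (f xs)))"
proof -
  define root where "root k = (LEAST s. Suc k - triangle (Suc s) = 0)" for k
  have root: "root k = fst (prod_decode k) + snd (prod_decode k)" for k
    using Least_triangle_prod_encode[of "fst (prod_decode k)" "snd (prod_decode k)"]
    by (simp add: root_def)
  have enc: "triangle (root k) + fst (prod_decode k) = k" for k
    using arg_cong[OF prod_decode_inverse[of k], of id]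
    by (cases "prod_decode k") (simp add: root prod_encode_def)
  have "recursive_fn (Suc 0)
      (\<lambda>xs. LEAST s. Suc ((s # xs) ! 1) - triangle (Suc ((s # xs) ! 0)) = 0)"
  proof (rule recursive_fn.minim[where f = "\<lambda>ys. Suc (ys ! 1) - triangle (Suc (ys ! 0))"])
    \<comment> \<open>Regularity: for a code k the choice s = k works, since
      \<open>triangle (Suc k) = triangle k + Suc k\<close>.\<close>
    show "\<forall>xs. length xs = Suc 0 \<longrightarrow>
        (\<exists>s. Suc ((s # xs) ! 1) - triangle (Suc ((s # xs) ! 0)) = 0)"
      by (intro allI impI, rule_tac x = "xs ! 0" in exI) simp
  qed (intro recursive_diff recursive_triangle recursive_Suc recursive_fn.proj; simp)
  then have "recursive_fn 1 (\<lambda>xs. root (xs ! 0))"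
    by (simp add: root_def)
  from recursive_comp1[OF this assms] have r: "recursive_fn n (\<lambda>xs. root (f xs))" .
  have fst_eq: "fst (prod_decode k) = k - triangle (root k)" for k
    using enc[of k] by simp
  have snd_eq: "snd (prod_decode k) = root k - fst (prod_decode k)" for k
    by (simp add: root)
  show fst: "recursive_fn n (\<lambda>xs. fst (prod_decode (f xs)))"
    unfolding fst_eq by (intro recursive_diff recursive_triangle r assms)
  show "recursive_fn n (\<lambda>xs. snd (prod_decode (f xs)))"
    unfolding snd_eq by (intro recursive_diff r fst)
qed

section \<open>Languages decided on list codes\<close>

definition recursive_lang :: "nat list set \<Rightarrow> bool" where
  "recursive_lang L \<longleftrightarrow> recursive_fn 1 (\<lambda>xs. of_bool (list_decode (xs ! 0) \<in> L))"

lemma list_decode_eq_Nil_iff: "list_decode c = [] \<longleftrightarrow> c = 0"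
  by (cases c) (auto split: prod.splits)

text \<open>A positive code is the successor of the pair of the head and the code of the tail. The
  test \<open>c = 0\<close> is separate because \<open>c - 1\<close> would read the empty word as
  the pair (0, 0).\<close>

lemma list_decode_Cons_image_iff:
  "list_decode c \<in> (#) x ` L \<longleftrightarrow>
    \<not> c = 0 \<and> fst (prod_decode (c - 1)) = x \<and> list_decode (snd (prod_decode (c - 1))) \<in> L"
  by (cases c) (auto split: prod.splits)

lemma recursive_lang_UN:
  assumes "finite I" "\<And>i. i \<in> I \<Longrightarrow> recursive_lang (L i)"
  shows "recursive_lang (\<Union>i\<in>I. L i)"
  using assms
proof (induction I)
  case empty
  then show ?case using recursive_const[of 1 0] by (simp add: recursive_lang_def)
next
  case (insert i I)
  then have "recursive_lang (L i)" "recursive_lang (\<Union>i\<in>I. L i)"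
    by simp_all
  then show ?case
    unfolding recursive_lang_def UN_insert Un_iff by (rule recursive_disj)
qed

lemma recursive_lang_Nil: "recursive_lang {[]}"
  unfolding recursive_lang_def singleton_iff list_decode_eq_Nil_iff
  by (intro recursive_eq recursive_const recursive_fn.proj) simp

lemma recursive_lang_Cons:
  assumes "recursive_lang L"
  shows "recursive_lang ((#) x ` L)"
  unfolding recursive_lang_def list_decode_Cons_image_iff
  by (intro recursive_conj recursive_Not recursive_eq recursive_const recursive_fst_prod_decode
      recursive_comp1[OF assms[unfolded recursive_lang_def]]
      recursive_snd_prod_decode recursive_pred recursive_fn.proj) simp_all

lemma recursive_lang_append:
  assumes "recursive_lang L"
  shows "recursive_lang ((@) w ` L)"
proof (induction w)
  case (Cons x w)
  have "(@) (x # w) ` L = (#) x ` (@) w ` L"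
    by (auto simp: image_iff)
  then show ?case using recursive_lang_Cons[OF Cons] by simp
qed (use assms in simp)

lemma recursive_lang_finite:
  assumes "finite L"
  shows "recursive_lang L"
  using recursive_lang_UN[OF assms recursive_lang_append[OF recursive_lang_Nil], of "\<lambda>w. w"]
  by simp

text \<open>Repeatedly removing a head that lies in \<open>Z\<close> empties exactly the lists over \<open>Z\<close>.\<close>

lemma recursive_lang_lists:
  assumes "finite Z"
  shows "recursive_lang (lists Z)"
proof -
  \<comment> \<open>The exponent is 1 if the head lies in \<open>Z\<close> and 0 otherwise, so a
    round drops an admissible head and leaves other codes unchanged.\<close>
  define F where "F c = ((\<lambda>d. snd (prod_decode (d - 1))) ^^
      of_bool (fst (prod_decode (c - 1)) \<in> Z)) c" for c
  have rec_F: "recursive_fn 1 (\<lambda>xs. F (xs ! 0))"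
    unfolding F_def
    by (intro recursive_funpow recursive_finite_mem assms recursive_fst_prod_decode
      recursive_snd_prod_decode recursive_pred recursive_fn.proj) simp_all
  have F_0: "F 0 = 0"
    using prod_encode_inverse[of "(0, 0)"] by (simp add: F_def prod_encode_def)
  have F_Suc: "F (Suc (prod_encode (x, c))) = (if x \<in> Z then c else Suc (prod_encode (x, c)))" for x c
    by (simp add: F_def)
  have cases: "c = 0 \<or> (\<exists>x d. c = Suc (prod_encode (x, d)))" for c
  proof (cases c)
    case (Suc n)
    then show ?thesis
      using prod_decode_inverse[of n] by (cases "prod_decode n") auto
  qed simp
  have F_lists: "list_decode (F c) \<in> lists Z \<longleftrightarrow> list_decode c \<in> lists Z" for c
    using cases[of c] by (elim disjE exE) (simp_all add: F_0 F_Suc)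
  have iter_lists: "list_decode ((F ^^ n) c) \<in> lists Z \<longleftrightarrow> list_decode c \<in> lists Z" for n c
    by (induction n) (auto simp: F_lists)
  have F_le: "F c \<le> c - 1" if "list_decode c \<in> lists Z" for c
    using cases[of c] that by (elim disjE exE) (simp_all add: F_0 F_Suc le_prod_encode_2)
  have iter_le: "(F ^^ n) c \<le> c - n" if "list_decode c \<in> lists Z" for n c
  proof (induction n)
    case (Suc n)
    have "F ((F ^^ n) c) \<le> (F ^^ n) c - 1"
      using that by (intro F_le) (simp add: iter_lists)
    with Suc show ?case by simp
  qed simp
  \<comment> \<open>On a list over \<open>Z\<close> each round lowers a positive code, so
    \<open>c\<close> rounds reach 0. Conversely 0 codes the empty list, and \<open>F\<close>
    preserves membership in \<open>lists Z\<close> in both directions.\<close>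
  have "list_decode c \<in> lists Z \<longleftrightarrow> (F ^^ c) c = 0" for c
    using iter_le[of c c] iter_lists[of c c] by auto
  then show ?thesis
    unfolding recursive_lang_def
    by (simp only:) (intro recursive_eq recursive_funpow rec_F recursive_const recursive_fn.proj; simp)
qed


section \<open>Total weight of the histories of a given length\<close>

abbreviation histories_of_length ::
    "'a set \<Rightarrow> 'o percept set \<Rightarrow> nat \<Rightarrow> ('a, 'o) history set" where
  "histories_of_length A E n \<equiv> {h. h \<in> histories A E \<and> length h = n}"

lemma finite_histories_of_length:
  assumes "finite A" "finite E"
  shows "finite (histories_of_length A E n)"
  using finite_lists_length_eq[OF finite_cartesian_product[OF assms], of n]
  by (simp add: histories_def in_lists_conv_set subset_code(1))

lemma histories_Nil: "[] \<in> histories A E"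
  by (simp add: histories_def)

lemma histories_snoc: "h @ [(a, e)] \<in> histories A E \<longleftrightarrow> h \<in> histories A E \<and> a \<in> A \<and> e \<in> E"
  by (auto simp: histories_def)

lemma policy_weight_snoc:
  "policy_weight \<pi> (h @ [(a, e)]) = policy_weight \<pi> h * pmf (\<pi> h) a"
  by (simp add: policy_weight_def nth_append)

text \<open>Summing over the last percept gives the factor \<open>c\<close>, because the weight
  ignores it; summing over the last action then gives 1. The uses are the constant 1 with
  \<open>c = card E\<close> and a measure with \<open>c = 1\<close>.\<close>

lemma sum_policy_weight:
  fixes \<nu> :: "('a, 'o) history \<Rightarrow> real"
  assumes fin: "finite A" "finite E" and \<pi>: "is_policy A E \<pi>"
    and step: "\<And>h a. h \<in> histories A E \<Longrightarrow> a \<in> A \<Longrightarrow> (\<Sum>e\<in>E. \<nu> (h @ [(a, e)])) = c * \<nu> h"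
  shows "(\<Sum>h\<in>histories_of_length A E n. \<nu> h * policy_weight \<pi> h) = c ^ n * \<nu> []"
proof (induction n)
  case 0
  have "histories_of_length A E 0 = {[]}"
    by (auto simp: histories_Nil)
  then show ?case by (simp add: policy_weight_def)
next
  case (Suc n)
  let ?H = "histories_of_length A E n"
  have img: "histories_of_length A E (Suc n) = (\<lambda>(h, a, e). h @ [(a, e)]) ` (?H \<times> A \<times> E)"
  proof -
    have "h \<in> (\<lambda>(h, a, e). h @ [(a, e)]) ` (?H \<times> A \<times> E)"
      if "h \<in> histories_of_length A E (Suc n)" for h
      using that by (cases h rule: rev_cases) (force simp: histories_snoc)+
    then show ?thesis by (auto simp: histories_snoc)
  qed
  have inj: "inj_on (\<lambda>(h, a, e). h @ [(a, e)]) (?H \<times> A \<times> E)"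
    by (auto simp: inj_on_def)
  have "(\<Sum>h\<in>histories_of_length A E (Suc n). \<nu> h * policy_weight \<pi> h) =
      (\<Sum>(h, a, e)\<in>?H \<times> A \<times> E. \<nu> (h @ [(a, e)]) * policy_weight \<pi> (h @ [(a, e)]))"
    unfolding img by (subst sum.reindex[OF inj]) (simp add: case_prod_unfold)
  also have "\<dots> = (\<Sum>h\<in>?H. \<Sum>a\<in>A. \<Sum>e\<in>E. \<nu> (h @ [(a, e)]) * policy_weight \<pi> (h @ [(a, e)]))"
    by (simp add: sum.cartesian_product case_prod_unfold)
  also have "\<dots> = (\<Sum>h\<in>?H. \<Sum>a\<in>A. (\<Sum>e\<in>E. \<nu> (h @ [(a, e)])) * (policy_weight \<pi> h * pmf (\<pi> h) a))"
    by (simp add: policy_weight_snoc sum_distrib_right)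
  also have "\<dots> = (\<Sum>h\<in>?H. \<Sum>a\<in>A. c * (\<nu> h * policy_weight \<pi> h) * pmf (\<pi> h) a)"
    by (intro sum.cong) (auto simp: step)
  also have "\<dots> = (\<Sum>h\<in>?H. c * (\<nu> h * policy_weight \<pi> h))"
    using \<pi> fin by (intro sum.cong) (auto simp: is_policy_def sum_pmf_eq_1 simp flip: sum_distrib_left)
  also have "\<dots> = c ^ Suc n * \<nu> []"
    by (simp add: Suc flip: sum_distrib_left)
  finally show ?case .
qed

text \<open>The two totals agree, so a pointwise inequality everywhere would be an equality
  everywhere, against \<open>h\<close>.\<close>

lemma ex_greater_policy_weight:
  assumes fin: "finite A" "finite E" and \<pi>: "is_policy A E \<pi>" "is_policy A E \<pi>'"
    and h: "h \<in> histories_of_length A E n" "policy_weight \<pi> h \<noteq> policy_weight \<pi>' h"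
  obtains g where "g \<in> histories_of_length A E n" "policy_weight \<pi> g > policy_weight \<pi>' g"
proof -
  let ?H = "histories_of_length A E n"
  have "sum (policy_weight \<pi>) ?H = sum (policy_weight \<pi>') ?H"
    using sum_policy_weight[OF fin \<pi>(1), of "\<lambda>_. 1" "card E" n]
      sum_policy_weight[OF fin \<pi>(2), of "\<lambda>_. 1" "card E" n] by simp
  then have "\<not> (\<forall>g\<in>?H. policy_weight \<pi> g \<le> policy_weight \<pi>' g)"
    using sum_mono_inv[OF _ _ h(1) finite_histories_of_length[OF fin],
        of "policy_weight \<pi>" "policy_weight \<pi>'"] h(2) by blast
  with that show ?thesis by force
qed


section \<open>Deterministic environments\<close>

definition answered_by ::
    "(('a, 'o) history \<Rightarrow> 'a \<Rightarrow> 'o percept) \<Rightarrow> ('a, 'o) history \<Rightarrow> bool" where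
  "answered_by f h \<longleftrightarrow> (\<forall>i<length h. snd (h ! i) = f (take i h) (fst (h ! i)))"

text \<open>\<open>restrict\<close> puts the environment into the extensional function space that
  \<open>ccs\<close> requires.\<close>

definition det_env ::
    "'a set \<Rightarrow> 'o percept set \<Rightarrow> (('a, 'o) history \<Rightarrow> 'a \<Rightarrow> 'o percept) \<Rightarrow> ('a, 'o) environment"
  where
  "det_env A E f = restrict (\<lambda>h. of_bool (answered_by f h)) (histories A E)"

lemma answered_by_Nil: "answered_by f []"
  by (simp add: answered_by_def)

lemma answered_by_snoc: "answered_by f (h @ [(a, e)]) \<longleftrightarrow> answered_by f h \<and> e = f h a"
  by (auto simp: answered_by_def nth_append less_Suc_eq)

text \<open>For each action an answered history has exactly one answered continuation, and its
  percept lies in \<open>E\<close>, so the whole mass passes on.\<close>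

lemma ccm_det_env:
  assumes "finite E" and f: "\<And>h a. f h a \<in> E"
  shows "ccm A E (det_env A E f)"
proof -
  have "(\<Sum>e\<in>E. det_env A E f (h @ [(a, e)])) = det_env A E f h"
    if "h \<in> histories A E" "a \<in> A" for h a
  proof -
    have "(\<Sum>e\<in>E. det_env A E f (h @ [(a, e)])) =
        (\<Sum>e\<in>E. if f h a = e then of_bool (answered_by f h) else 0)"
      using that by (intro sum.cong) (auto simp: det_env_def histories_snoc answered_by_snoc)
    also have "\<dots> = det_env A E f h"
      using that f assms(1) by (simp add: det_env_def)
    finally show ?thesis .
  qed
  then show ?thesis
    by (auto simp: ccm_def ccs_def det_env_def histories_Nil answered_by_Nil)
qed

text \<open>From length \<open>k\<close> on the only correct percept is \<open>z\<close>, whatever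
  the actions, so the tail is constrained letter by letter.\<close>

lemma answered_by_append_const:
  assumes "\<And>h a. k \<le> length h \<Longrightarrow> f h a = z" "k \<le> length w"
  shows "answered_by f (w @ t) \<longleftrightarrow> answered_by f w \<and> snd ` set t \<subseteq> {z}"
proof (induction t rule: rev_induct)
  case (snoc x t)
  then show ?case
    using answered_by_snoc[of f "w @ t" "fst x" "snd x"] assms by auto
qed simp

lemma computable_det_env:
  assumes fin: "finite A" "finite E"
    and const: "\<And>h a. k \<le> length h \<Longrightarrow> f h a = z"
  shows "computable_env A E (det_env A E f)"
proof -
  define enc where "enc = map (to_nat_on (A \<times> E))"
  define Fin where "Fin n = {h \<in> histories_of_length A E n. answered_by f h}" for n
  \<comment> \<open>Answered histories shorter than \<open>k\<close>, and those of length
    \<open>k\<close> followed by any letters with percept \<open>z\<close>; intersecting with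
    \<open>E\<close> keeps these letters in the alphabet.\<close>
  define L where "L = (\<Union>n\<in>{..<k}. enc ` Fin n) \<union>
    (\<Union>w\<in>Fin k. (@) (enc w) ` lists (to_nat_on (A \<times> E) ` (A \<times> ({z} \<inter> E))))"
  have fin_Fin: "finite (Fin n)" for n
    unfolding Fin_def by (rule finite_subset[OF _ finite_histories_of_length[OF fin, of n]]) auto
  have "recursive_lang (\<Union>n\<in>{..<k}. enc ` Fin n)"
    by (intro recursive_lang_finite finite_UN_I finite_imageI fin_Fin finite_lessThan)
  moreover have "recursive_lang
      (\<Union>w\<in>Fin k. (@) (enc w) ` lists (to_nat_on (A \<times> E) ` (A \<times> ({z} \<inter> E))))"
    using fin by (intro recursive_lang_UN recursive_lang_append recursive_lang_lists fin_Fin) auto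
  ultimately have "recursive_lang L"
    unfolding L_def recursive_lang_def Un_iff by (rule recursive_disj)
  then have rec: "recursive_fn 2 (\<lambda>xs. of_bool (list_decode (xs ! 0) \<in> L))"
    unfolding recursive_lang_def
    by (rule recursive_comp1[where F = "\<lambda>c. of_bool (list_decode c \<in> L)"])
      (simp add: recursive_fn.proj)
  have inj: "inj_on enc (histories A E)"
    unfolding enc_def histories_def
    using fin by (intro inj_on_mapI)
     (auto intro!: inj_on_subset[OF inj_on_to_nat_on] countable_finite)
  have mem_L: "enc h \<in> L \<longleftrightarrow> answered_by f h" if h: "h \<in> histories A E" for h
  proof
    assume "enc h \<in> L"
    then consider g where "g \<in> histories A E" "answered_by f g" "enc h = enc g"
      | w l where "w \<in> Fin k" "l \<in> lists (to_nat_on (A \<times> E) ` (A \<times> ({z} \<inter> E)))" "enc h = enc w @ l"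
      by (auto simp: L_def Fin_def)
    then obtain g where "g \<in> histories A E" "answered_by f g" "enc h = enc g"
    proof cases
      case (2 w l)
      then obtain t where t: "t \<in> lists (A \<times> ({z} \<inter> E))" "l = enc t"
        by (auto simp: enc_def lists_image)
      with 2 have "w @ t \<in> histories A E" "answered_by f (w @ t)" "enc h = enc (w @ t)"
        by (auto simp: Fin_def histories_def enc_def answered_by_append_const[OF const])
      then show ?thesis using that by blast
    qed (use that in blast)
    with inj_onD[OF inj] h show "answered_by f h" by blast
  next
    assume *: "answered_by f h"
    show "enc h \<in> L"
    proof (cases "length h < k")
      case True
      with * h show ?thesis by (auto simp: L_def Fin_def)
    next
      case False
      then have "answered_by f (take k h) \<and> snd ` set (drop k h) \<subseteq> {z}"
        using * answered_by_append_const[OF const, where w = "take k h" and t = "drop k h"] by simp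
      moreover have "take k h \<in> histories A E" "set (drop k h) \<subseteq> A \<times> E"
        using h set_take_subset[of k h] set_drop_subset[of k h] by (auto simp: histories_def)
      ultimately have "take k h \<in> Fin k" "drop k h \<in> lists (A \<times> ({z} \<inter> E))"
        using False by (auto simp: Fin_def)
      moreover have "enc h = enc (take k h) @ enc (drop k h)"
        by (simp add: enc_def flip: map_append)
      ultimately show ?thesis
        unfolding L_def enc_def lists_image by blast
    qed
  qed
  \<comment> \<open>The value is 0 or 1, so the indicator of \<open>L\<close> over denominator
    \<open>Suc 0\<close> is exact at every precision. The \<open>k\<close> fixed below is the
    precision, not the length bound.\<close>
  show ?thesis
    unfolding computable_env_def computable_real_on_def
  proof (rule exI[of _ "\<lambda>_. 0"], rule exI[of _ "\<lambda>xs. of_bool (list_decode (xs ! 0) \<in> L)"],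
      rule exI[of _ "\<lambda>_. 0"], intro conjI ballI allI recursive_const rec)
    fix h k assume "h \<in> histories A E"
    then show "\<bar>det_env A E f h - (-1) ^ 0 *
        real (of_bool (list_decode ([history_code A E h, k] ! 0) \<in> L)) / real (Suc 0)\<bar> \<le> 1 / 2 ^ k"
      using mem_L[of h] by (simp add: det_env_def history_code_def enc_def)
  qed
qed


section \<open>Rewarding a single history\<close>

text \<open>Comparing the completed history with \<open>g\<close> tests all past actions and the
  current one at once, and can succeed only at the last step of \<open>g\<close>.\<close>

definition probe ::
    "('a, 'o) history \<Rightarrow> 'o percept \<Rightarrow> ('a, 'o) history \<Rightarrow> 'a \<Rightarrow> 'o percept" where
  "probe g z h a =
    (if Suc (length h) < length g \<or> h @ [(a, snd (last g))] = g
     then snd (g ! length h) else z)"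

text \<open>Before the last step the first condition of \<open>probe\<close> holds; at the last step
  the prefix completed by the last letter is \<open>g\<close>, so the second one does.\<close>

lemma answered_by_probe_self: "answered_by (probe g z) g"
proof -
  have "take i g @ [(fst (g ! i), snd (last g))] = g" if "Suc i = length g" for i
  proof -
    have "last g = g ! i"
      using that last_conv_nth[of g] by (cases g) auto
    then show ?thesis
      using that take_Suc_conv_app_nth[of i g] by simp
  qed
  then show ?thesis
    by (auto simp: answered_by_def probe_def)
qed

lemma probe_after:
  assumes "length g \<le> length h"
  shows "probe g z h a = z"
proof -
  have "h @ [(a, snd (last g))] \<noteq> g"
    using assms by (intro notI) (drule arg_cong[of _ _ length], simp)
  with assms show ?thesis
    by (simp add: probe_def)
qed

lemma probe_percept:
  assumes "g \<in> histories A E" "z \<in> E"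
  shows "probe g z h a \<in> E"
proof -
  have "snd (g ! i) \<in> E" if "i < length g" for i
    using assms(1) nth_mem[OF that] by (auto simp: histories_def)
  moreover have "length h < length g" if "h @ [(a, snd (last g))] = g"
    using arg_cong[OF that, of length] by simp
  ultimately show ?thesis
    using assms(2) by (auto simp: probe_def)
qed

text \<open>The reward at time \<open>n + 1\<close> is the same on all answered histories, and their
  total probability is 1 because the environment is a measure.\<close>

lemma expected_reward_probe_before:
  assumes fin: "finite A" "finite E" and \<pi>: "is_policy A E \<pi>"
    and g: "g \<in> histories A E" "z \<in> E" and n: "Suc n < length g"
  shows "expected_reward A E \<pi> (det_env A E (probe g z)) (Suc n) = snd (snd (g ! n))"
proof -
  let ?\<nu> = "det_env A E (probe g z)"
  have "last_reward h * ?\<nu> h = snd (snd (g ! n)) * ?\<nu> h"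
    if "h \<in> histories_of_length A E (Suc n)" for h
  proof -
    from that obtain h' a e where "h = h' @ [(a, e)]" "length h' = n"
      by (cases h rule: rev_cases) auto
    then show ?thesis
      using that n by (auto simp: det_env_def answered_by_snoc probe_def last_reward_def)
  qed
  then have "expected_reward A E \<pi> ?\<nu> (Suc n) =
      (\<Sum>h\<in>histories_of_length A E (Suc n). snd (snd (g ! n)) * (?\<nu> h * policy_weight \<pi> h))"
    unfolding expected_reward_def by (intro sum.cong) (auto simp flip: mult.assoc)
  also have "\<dots> = snd (snd (g ! n)) * (1 ^ Suc n * ?\<nu> [])"
  proof -
    have "ccm A E ?\<nu>"
      using g by (intro ccm_det_env fin probe_percept)
    then show ?thesis
      unfolding sum_distrib_left[symmetric]
      by (subst sum_policy_weight[OF fin \<pi>, where c = 1]) (auto simp: ccm_def)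
  qed
  finally show ?thesis
    by (simp add: det_env_def histories_Nil answered_by_Nil)
qed

text \<open>Only \<open>g\<close> earns a reward here: every other answered history of this length
  ends in \<open>z\<close>.\<close>

lemma expected_reward_probe_at:
  assumes fin: "finite A" "finite E"
    and g: "g \<in> histories_of_length A E (Suc m)" "snd (snd (last g)) = 1" "snd z = 0"
  shows "expected_reward A E \<pi> (det_env A E (probe g z)) (Suc m) = policy_weight \<pi> g"
proof -
  let ?\<nu> = "det_env A E (probe g z)"
  have "last_reward h * ?\<nu> h = of_bool (h = g)" if h: "h \<in> histories_of_length A E (Suc m)" for h
  proof (cases "h = g")
    case True
    with g show ?thesis by (simp add: det_env_def answered_by_probe_self last_reward_def)
  next
    case False
    from h obtain h' a e where h': "h = h' @ [(a, e)]" "length h' = m"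
      by (cases h rule: rev_cases) auto
    \<comment> \<open>If the second condition of \<open>probe\<close> held, \<open>e\<close> would
      be the last percept of \<open>g\<close> and the completed history would be \<open>h\<close>
      itself, giving \<open>h = g\<close>.\<close>
    have "e = z" if "answered_by (probe g z) h"
    proof -
      have "e = probe g z h' a"
        using that by (simp add: h' answered_by_snoc)
      moreover have "e = snd (last g) \<Longrightarrow> h' @ [(a, snd (last g))] \<noteq> g"
        using False h' by auto
      moreover have "g ! m = last g"
        using g by (cases g) (auto simp: last_conv_nth)
      ultimately show ?thesis
        using h' g(1) by (auto simp: probe_def split: if_splits)
    qed
    with False h h' g(3) show ?thesis
      by (auto simp: det_env_def last_reward_def)
  qed
  then have "expected_reward A E \<pi> ?\<nu> (Suc m) =
      (\<Sum>h\<in>histories_of_length A E (Suc m). if h = g then policy_weight \<pi> g else 0)"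
    unfolding expected_reward_def by (intro sum.cong) auto
  also have "\<dots> = policy_weight \<pi> g"
    using g by (subst sum.delta[OF finite_histories_of_length[OF fin]]) simp
  finally show ?thesis .
qed

lemma expected_reward_probe_after:
  assumes "length g \<le> n" "snd z = 0"
  shows "expected_reward A E \<pi> (det_env A E (probe g z)) (Suc n) = 0"
proof -
  let ?\<nu> = "det_env A E (probe g z)"
  have "last_reward h * ?\<nu> h = 0" if "h \<in> histories_of_length A E (Suc n)" for h
  proof -
    from that obtain h' a e where h': "h = h' @ [(a, e)]" "length h' = n"
      by (cases h rule: rev_cases) auto
    then have "probe g z h' a = z"
      using assms(1) by (simp add: probe_after)
    with that h' assms(2) show ?thesis
      by (auto simp: det_env_def answered_by_snoc last_reward_def)
  qed
  then show ?thesis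
    unfolding expected_reward_def by (intro sum.neutral) auto
qed

text \<open>The series ends at time \<open>m + 1\<close>, and its earlier terms are the same for
  every policy, so policies are compared through their weights of \<open>g\<close> alone.\<close>

lemma policy_value_probe:
  assumes fin: "finite A" "finite E" and \<pi>: "is_policy A E \<pi>"
    and g: "g \<in> histories_of_length A E (Suc m)" "snd (snd (last g)) = 1"
    and z: "z \<in> E" "snd z = 0" and pos: "discount_tail \<gamma> 1 > 0"
  shows "policy_value A E \<gamma> \<pi> (det_env A E (probe g z)) =
    ((\<Sum>j<m. \<gamma> (j + 1) * snd (snd (g ! j))) + \<gamma> (m + 1) * policy_weight \<pi> g) / discount_tail \<gamma> 1"
proof -
  let ?r = "\<lambda>j. \<gamma> (j + 1) * expected_reward A E \<pi> (det_env A E (probe g z)) (j + 1)"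
  have "suminf ?r = sum ?r {..<Suc m}"
    using g z by (intro suminf_finite) (auto simp: expected_reward_probe_after)
  also have "\<dots> = sum ?r {..<m} + ?r m"
    by (rule sum.lessThan_Suc)
  also have "sum ?r {..<m} = (\<Sum>j<m. \<gamma> (j + 1) * snd (snd (g ! j)))"
    using g z by (intro sum.cong) (auto simp: expected_reward_probe_before[OF fin \<pi>])
  also have "?r m = \<gamma> (m + 1) * policy_weight \<pi> g"
    using expected_reward_probe_at[OF fin g z(2)] by simp
  finally show ?thesis
    using pos by (simp add: policy_value_def)
qed

section \<open>Refutation of a dominating policy\<close>

theorem theorem5p3:
  fixes A :: "'a set" and E :: "'o percept set" and \<gamma> :: "nat \<Rightarrow> real"
    and M :: "('a, 'o) environment set" and \<pi> :: "('a, 'o) policy"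
  assumes "finite A" and "finite E"
    and "\<forall>(o', r)\<in>E. 0 \<le> r \<and> r \<le> 1"
    and "\<exists>o'. (o', 0) \<in> E \<and> (o', 1) \<in> E"
    and "discount \<gamma>"
    and "\<forall>\<nu>\<in>M. ccs A E \<nu>"
    and "\<forall>\<nu>. ccm A E \<nu> \<and> computable_env A E \<nu> \<longrightarrow> \<nu> \<in> M"
    and "is_policy A E \<pi>"
  shows "pareto_optimal A E \<gamma> M \<pi>"
  unfolding pareto_optimal_def
proof
  assume "\<exists>\<pi>'. is_policy A E \<pi>' \<and>
    (\<forall>\<nu>\<in>M. policy_value A E \<gamma> \<pi>' \<nu> \<ge> policy_value A E \<gamma> \<pi> \<nu>) \<and>
    (\<exists>\<rho>\<in>M. policy_value A E \<gamma> \<pi>' \<rho> > policy_value A E \<gamma> \<pi> \<rho>)"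
  then obtain \<pi>' \<rho> where \<pi>': "is_policy A E \<pi>'"
    and dom: "\<And>\<nu>. \<nu> \<in> M \<Longrightarrow> policy_value A E \<gamma> \<pi>' \<nu> \<ge> policy_value A E \<gamma> \<pi> \<nu>"
    and strict: "policy_value A E \<gamma> \<pi>' \<rho> > policy_value A E \<gamma> \<pi> \<rho>"
    by blast
  \<comment> \<open>Otherwise both values would be 0 by the default case.\<close>
  from strict have pos: "discount_tail \<gamma> 1 > 0"
    by (auto simp: policy_value_def split: if_splits)
  \<comment> \<open>Equal summands would give equal values, so the summands differ at some time,
    where the discount cannot vanish.\<close>
  have "(\<lambda>k. \<gamma> (k + 1) * expected_reward A E \<pi> \<rho> (k + 1)) \<noteq>
      (\<lambda>k. \<gamma> (k + 1) * expected_reward A E \<pi>' \<rho> (k + 1))"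
  proof
    assume "(\<lambda>k. \<gamma> (k + 1) * expected_reward A E \<pi> \<rho> (k + 1)) =
      (\<lambda>k. \<gamma> (k + 1) * expected_reward A E \<pi>' \<rho> (k + 1))"
    with strict show False
      unfolding policy_value_def by (simp only: less_irrefl)
  qed
  then obtain m where m: "\<gamma> (m + 1) \<noteq> 0"
      "expected_reward A E \<pi> \<rho> (Suc m) \<noteq> expected_reward A E \<pi>' \<rho> (Suc m)"
    by (metis Suc_eq_plus1 mult_zero_left)
  then have \<gamma>_pos: "\<gamma> (m + 1) > 0"
    using \<open>discount \<gamma>\<close> by (simp add: discount_def order_less_le)
  from m(2) obtain h where "h \<in> histories_of_length A E (Suc m)"
      "policy_weight \<pi> h \<noteq> policy_weight \<pi>' h"
    unfolding expected_reward_def by (metis (no_types, lifting) sum.cong)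
  then obtain g where g: "g \<in> histories_of_length A E (Suc m)"
      "policy_weight \<pi> g > policy_weight \<pi>' g"
    by (rule ex_greater_policy_weight[OF assms(1,2,8) \<pi>'])
  obtain o' where o': "(o', 0) \<in> E" "(o', 1) \<in> E"
    using assms(4) by blast
  from g(1) obtain g' a e where g': "g = g' @ [(a, e)]"
    by (cases g rule: rev_cases) auto
  \<comment> \<open>Changing the last percept of \<open>g\<close> keeps its weight under both
    policies, and reward 1 makes that weight count in full.\<close>
  define u where "u = g' @ [(a, (o', 1 :: real))]"
  have u: "u \<in> histories_of_length A E (Suc m)" "snd (snd (last u)) = 1"
    using g(1) o' by (auto simp: u_def g' histories_snoc)
  have weight: "policy_weight \<pi> u > policy_weight \<pi>' u"
    using g(2) by (simp add: u_def g' policy_weight_snoc)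
  let ?\<nu> = "det_env A E (probe u (o', 0))"
  have "ccm A E ?\<nu>"
    using u(1) o'(1) by (intro ccm_det_env assms(2) probe_percept) auto
  moreover have "computable_env A E ?\<nu>"
    by (rule computable_det_env[OF assms(1,2), of "length u" _ "(o', 0)"]) (rule probe_after)
  ultimately have "policy_value A E \<gamma> \<pi>' ?\<nu> \<ge> policy_value A E \<gamma> \<pi> ?\<nu>"
    using assms(7) dom by blast
  moreover have "policy_value A E \<gamma> \<pi>' ?\<nu> < policy_value A E \<gamma> \<pi> ?\<nu>"
    using weight \<gamma>_pos pos policy_value_probe[OF assms(1,2) \<pi>' u o'(1) _ pos]
      policy_value_probe[OF assms(1,2,8) u o'(1) _ pos]
    by (simp add: divide_strict_right_mono)
  ultimately show False by simp
qed

end
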